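(* Let $X$ be a non-empty finite set, let $C$ be a family of subsets of $X$ with $|C|\ge 2$, let $Z=X\times\{0,1\}$, and let $c\models(x,b)$ if and only if ($b=1$ and $x\in c$) or ($b=0$ and $x\notin c$). Then $$\mathrm{MAP\text{-}TD}^{O,\overline{R}}(C)=\mathrm{SMN}(G(C)^{O,\overline{R}})\quad\text{and}\quad\mathrm{MLE\text{-}TD}^{O,\overline{R}}(C)=\mathrm{SMN}(G(C)^{O,\overline{R}}_{\neq\emptyset}).$$
   Context: $\mathcal{Z}^{O,\overline{R}}$ is the set of repetition-free sequences over $Z$, including the empty sequence $\emptyset$; $|\mathbf{z}|$ is the length of $\mathbf{z}$; $c\models\mathbf{z}$ means $c\models z$ for every $z$ occurring in $\mathbf{z}$. (Ordered sampling without replacement.) For a probability vector $Q=(q(z))_{z\in Z}$ and a repetition-free sequence $(z_1,\dots,z_n)$ with $n\le|\{z:q(z)>0\}|$, $P^{O,\overline{R}}((z_1,\dots,z_n)|Q)=\prod_{i=1}^n \frac{q(z_i)}{1-(q(z_1)+\dots+q(z_{i-1}))}$ (equal to $1$ for the empty sequence). A MAP-learner $L$ for $C$ is given by priors $P(c)>0$ with $\sum_{c\in C}P(c)=1$ and conditional likelihoods $P(z|c)\ge 0$ with $\sum_{z\in Z}P(z|c)=1$ for each $c\in C$, subject to: $c\not\models z$ implies $P(z|c)=0$. An MLE-learner is a MAP-learner with uniform priors. Let $N^+(C,L)=\min_{c\in C}|\{z\in Z:P(z|c)>0\}|$. A teacher for $L$ is a map $T:C\to\mathcal{Z}^{O,\overline{R}}$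 such that for every $c_0\in C$: $|T(c_0)|\le N^+(C,L)$ and $c_0$ is the unique maximizer over $c\in C$ of $P(c)\cdot P^{O,\overline{R}}(T(c_0)|P(\cdot|c))$. Its order is $\max_{c\in C}|T(c)|$. $\mathrm{MAP\text{-}TD}^{O,\overline{R}}(C)$ (resp. $\mathrm{MLE\text{-}TD}^{O,\overline{R}}(C)$) is the smallest $d$ such that some MAP-learner (resp. MLE-learner) for $C$ has a teacher of order $d$. $G(C)^{O,\overline{R}}$ is the bipartite graph with vertex classes $C$ and $\mathcal{Z}^{O,\overline{R}}$ and edges $\{(c,\mathbf{z}):c\models\mathbf{z}\}$; $G(C)^{O,\overline{R}}_{\neq\emptyset}$ results from it by removing the vertex $\emptyset$ from the second class. A $C$-saturating matching is an injective map $M$ from $C$ to the second vertex class with $(c,M(c))$ an edge for each $c\in C$; its order is $\max_{c\in C}|M(c)|$. $\mathrm{SMN}(G)$ is the smallest possible order of a $C$-saturating matching in $G$. *)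

theory Defs
  imports Complex_Main "HOL-Library.Extended_Nat"
begin

definition seqs :: "'z set \<Rightarrow> 'z list set" where
  "seqs Z = {zs. distinct zs \<and> set zs \<subseteq> Z}"

definition seq_models :: "('c \<Rightarrow> 'z \<Rightarrow> bool) \<Rightarrow> 'c \<Rightarrow> 'z list \<Rightarrow> bool" where
  "seq_models models c zs \<longleftrightarrow> (\<forall>z\<in>set zs. models c z)"

text \<open>Ordered sampling without replacement. This is meant for probability vectors \<open>q\<close> and
  repetition-free \<open>zs\<close> no longer than the support of \<open>q\<close>; under these conditions each
  denominator is positive, because fewer than all support elements have been drawn. The length
  bound in \<open>teacher\<close> below guarantees this for every use of \<open>seq_prob\<close>.\<close>

definition seq_prob :: "('z \<Rightarrow> real) \<Rightarrow> 'z list \<Rightarrow> real" where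
  "seq_prob q zs = (\<Prod>i<length zs. q (zs ! i) / (1 - (\<Sum>j<i. q (zs ! j))))"

record ('c, 'z) learner =
  prior :: "'c \<Rightarrow> real"
  likelihood :: "'c \<Rightarrow> 'z \<Rightarrow> real"

definition map_learner ::
    "'c set \<Rightarrow> 'z set \<Rightarrow> ('c \<Rightarrow> 'z \<Rightarrow> bool) \<Rightarrow> ('c, 'z) learner \<Rightarrow> bool" where
  "map_learner C Z models L \<longleftrightarrow>
     (\<forall>c\<in>C. prior L c > 0) \<and> (\<Sum>c\<in>C. prior L c) = 1 \<and>
     (\<forall>c\<in>C. \<forall>z\<in>Z. likelihood L c z \<ge> 0) \<and>
     (\<forall>c\<in>C. (\<Sum>z\<in>Z. likelihood L c z) = 1) \<and>
     (\<forall>c\<in>C. \<forall>z\<in>Z. \<not> models c z \<longrightarrow> likelihood L c z = 0)"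

definition mle_learner ::
    "'c set \<Rightarrow> 'z set \<Rightarrow> ('c \<Rightarrow> 'z \<Rightarrow> bool) \<Rightarrow> ('c, 'z) learner \<Rightarrow> bool" where
  "mle_learner C Z models L \<longleftrightarrow>
     map_learner C Z models L \<and> (\<forall>c\<in>C. prior L c = 1 / real (card C))"

definition N_plus :: "'c set \<Rightarrow> 'z set \<Rightarrow> ('c, 'z) learner \<Rightarrow> nat" where
  "N_plus C Z L = Min ((\<lambda>c. card {z\<in>Z. likelihood L c z > 0}) ` C)"

definition score :: "('c, 'z) learner \<Rightarrow> 'z list \<Rightarrow> 'c \<Rightarrow> real" where
  "score L zs c = prior L c * seq_prob (likelihood L c) zs"

definition teacher ::
    "'c set \<Rightarrow> 'z set \<Rightarrow> ('c, 'z) learner \<Rightarrow> ('c \<Rightarrow> 'z list) \<Rightarrow> bool" where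
  "teacher C Z L T \<longleftrightarrow>
     (\<forall>c\<^sub>0\<in>C. T c\<^sub>0 \<in> seqs Z \<and> length (T c\<^sub>0) \<le> N_plus C Z L \<and>
        {c\<in>C. \<forall>c'\<in>C. score L (T c\<^sub>0) c' \<le> score L (T c\<^sub>0) c} = {c\<^sub>0})"

definition order_on :: "'c set \<Rightarrow> ('c \<Rightarrow> 'z list) \<Rightarrow> nat" where
  "order_on C T = Max ((\<lambda>c. length (T c)) ` C)"

text \<open>The parameters below are minima over sets of natural numbers. They are taken in \<^typ>\<open>enat\<close>,
  so that a minimum over the empty set is \<open>\<infinity>\<close> rather than an arbitrary number; over a nonempty
  set the infimum is attained.\<close>

definition MAP_TD :: "'c set \<Rightarrow> 'z set \<Rightarrow> ('c \<Rightarrow> 'z \<Rightarrow> bool) \<Rightarrow> enat" where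
  "MAP_TD C Z models =
     Inf {enat (order_on C T) | L T. map_learner C Z models L \<and> teacher C Z L T}"

definition MLE_TD :: "'c set \<Rightarrow> 'z set \<Rightarrow> ('c \<Rightarrow> 'z \<Rightarrow> bool) \<Rightarrow> enat" where
  "MLE_TD C Z models =
     Inf {enat (order_on C T) | L T. mle_learner C Z models L \<and> teacher C Z L T}"

record ('c, 'v) bigraph =
  left :: "'c set"
  right :: "'v set"
  edges :: "('c \<times> 'v) set"

definition consistency_graph ::
    "'c set \<Rightarrow> 'z set \<Rightarrow> ('c \<Rightarrow> 'z \<Rightarrow> bool) \<Rightarrow> ('c, 'z list) bigraph" where
  "consistency_graph C Z models =
     \<lparr>left = C, right = seqs Z,
      edges = {(c, zs). c \<in> C \<and> zs \<in> seqs Z \<and> seq_models models c zs}\<rparr>"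

definition remove_right :: "'v \<Rightarrow> ('c, 'v) bigraph \<Rightarrow> ('c, 'v) bigraph" where
  "remove_right v G =
     \<lparr>left = left G, right = right G - {v}, edges = {(c, w) \<in> edges G. w \<noteq> v}\<rparr>"

definition saturating_matching :: "('c, 'v) bigraph \<Rightarrow> ('c \<Rightarrow> 'v) \<Rightarrow> bool" where
  "saturating_matching G M \<longleftrightarrow>
     M ` left G \<subseteq> right G \<and> inj_on M (left G) \<and> (\<forall>c\<in>left G. (c, M c) \<in> edges G)"

definition SMN :: "('c, 'z list) bigraph \<Rightarrow> enat" where
  "SMN G = Inf {enat (order_on (left G) M) | M. saturating_matching G M}"

text \<open>Labelled examples \<open>(x, b)\<close>, with the labels 1 and 0 represented by \<^const>\<open>True\<close> and
  \<^const>\<open>False\<close>.\<close>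

definition examples :: "'a set \<Rightarrow> ('a \<times> bool) set" where
  "examples X = X \<times> UNIV"

definition label_models :: "'a set \<Rightarrow> 'a \<times> bool \<Rightarrow> bool" where
  "label_models c = (\<lambda>(x, b). (b \<and> x \<in> c) \<or> (\<not> b \<and> x \<notin> c))"

end

(* For both kinds of learners, the teachers are exactly the saturating matchings. Since a teacher's
   sequence is more likely under its concept than under any other, it has positive probability and
   so is consistent, and it determines the concept; with uniform priors it cannot be empty.
   Conversely, given a matching M, let the likelihoods of c put the fraction 1 - eps of the
   remaining mass on each entry of M c in turn and spread what is left evenly over the other
   examples consistent with c. Then M c has probability close to 1 under c. Under another
   concept c' its probability is at most 1/2, unless M c is a proper prefix of M c'; letting eps
   grow with the length of M c settles this last case. If M c is empty, a slightly larger prior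
   of c does. *)

theory Submission
  imports Defs "HOL-Library.Sublist"
begin

section \<open>Ordered sampling without replacement\<close>

lemma seq_prob_Nil [simp]: "seq_prob q [] = 1"
  by (simp add: seq_prob_def)

lemma seq_prob_cong:
  assumes "\<And>z. z \<in> set zs \<Longrightarrow> q z = q' z"
  shows "seq_prob q zs = seq_prob q' zs"
proof -
  have "q (zs ! i) = q' (zs ! i)" if "i < length zs" for i
    using assms that by simp
  then show ?thesis
    unfolding seq_prob_def
    by (intro prod.cong arg_cong2[where f = "(/)"] arg_cong2[where f = "(-)"] sum.cong) auto
qed

text \<open>Once \<open>z\<close> is drawn, the later draws follow \<open>q\<close> conditioned on
  not drawing \<open>z\<close>: dividing numerators and denominators by \<open>1 - q z\<close>
  leaves each factor unchanged.\<close>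

lemma seq_prob_Cons:
  assumes "q z \<noteq> 1"
  shows "seq_prob q (z # zs) = q z * seq_prob (\<lambda>y. q y / (1 - q z)) zs"
proof -
  have factor: "q (zs ! i) / (1 - (q z + (\<Sum>j<i. q (zs ! j))))
      = q (zs ! i) / (1 - q z) / (1 - (\<Sum>j<i. q (zs ! j) / (1 - q z)))" for i
  proof -
    have "1 - (\<Sum>j<i. q (zs ! j) / (1 - q z))
        = (1 - (q z + (\<Sum>j<i. q (zs ! j)))) / (1 - q z)"
      using assms by (simp add: sum_divide_distrib[symmetric] field_simps)
    then show ?thesis using assms by simp
  qed
  have "seq_prob q (z # zs)
      = q z * (\<Prod>i<length zs. q (zs ! i) / (1 - (q z + (\<Sum>j<i. q (zs ! j)))))"
    by (simp add: seq_prob_def prod.lessThan_Suc_shift sum.lessThan_Suc_shift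
        del: prod.lessThan_Suc sum.lessThan_Suc)
  also have "\<dots> = q z * seq_prob (\<lambda>y. q y / (1 - q z)) zs"
    by (simp only: seq_prob_def factor)
  finally show ?thesis .
qed

context
  fixes Z :: "'z set" and q :: "'z \<Rightarrow> real" and zs :: "'z list"
  assumes fin: "finite Z" and nonneg: "\<And>z. z \<in> Z \<Longrightarrow> q z \<ge> 0" and total: "sum q Z = 1"
    and zs: "distinct zs" "set zs \<subseteq> Z"
begin

lemma sum_nth_le_1:
  assumes "i \<le> length zs"
  shows "(\<Sum>j<i. q (zs ! j)) \<le> 1"
proof -
  have "inj_on ((!) zs) {..<i}"
    using zs assms by (auto simp: inj_on_def nth_eq_iff_index_eq)
  then have "(\<Sum>j<i. q (zs ! j)) = sum q ((!) zs ` {..<i})"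
    by (simp add: sum.reindex)
  also have "\<dots> \<le> sum q Z"
    using zs assms nonneg fin by (intro sum_mono2) (auto simp: subset_iff)
  finally show ?thesis using total by simp
qed

lemma seq_prob_factor:
  assumes "i < length zs"
  shows "0 \<le> q (zs ! i) / (1 - (\<Sum>j<i. q (zs ! j)))"
    and "q (zs ! i) / (1 - (\<Sum>j<i. q (zs ! j))) \<le> 1"
    and "q (zs ! i) > 0 \<Longrightarrow> 0 < q (zs ! i) / (1 - (\<Sum>j<i. q (zs ! j)))"
proof -
  \<comment> \<open>If the denominator vanishes, this bound and nonnegativity force
    \<open>q (zs ! i) = 0\<close>, and the quotient is 0, so the bounds cover that case too.\<close>
  have le: "q (zs ! i) \<le> 1 - (\<Sum>j<i. q (zs ! j))"
    using sum_nth_le_1[of "Suc i"] assms by simp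
  moreover have "q (zs ! i) \<ge> 0" using assms zs nonneg nth_mem by blast
  ultimately show "0 \<le> q (zs ! i) / (1 - (\<Sum>j<i. q (zs ! j)))"
    "q (zs ! i) / (1 - (\<Sum>j<i. q (zs ! j))) \<le> 1"
    "q (zs ! i) > 0 \<Longrightarrow> 0 < q (zs ! i) / (1 - (\<Sum>j<i. q (zs ! j)))"
    by (auto simp: divide_le_eq_1)
qed

lemma seq_prob_nonneg: "0 \<le> seq_prob q zs"
  unfolding seq_prob_def using seq_prob_factor(1) by (intro prod_nonneg) auto

lemma seq_prob_pos:
  assumes "\<And>z. z \<in> set zs \<Longrightarrow> q z > 0"
  shows "0 < seq_prob q zs"
  unfolding seq_prob_def using seq_prob_factor(3) assms by (intro prod_pos) auto

text \<open>The first denominator is 1 and all later factors are at most 1. This bounds sequences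
  with an unlikely first draw.\<close>

lemma seq_prob_le_hd:
  assumes "zs \<noteq> []"
  shows "seq_prob q zs \<le> q (hd zs)"
proof -
  have "q (zs ! 0) \<ge> 0"
    using assms zs nonneg by (meson length_greater_0_conv nth_mem subsetD)
  have "seq_prob q zs
      = q (zs ! 0) * (\<Prod>i\<in>{..<length zs} - {0}. q (zs ! i) / (1 - (\<Sum>j<i. q (zs ! j))))"
    unfolding seq_prob_def using assms by (subst prod.remove[of _ 0]) auto
  also have "\<dots> \<le> q (zs ! 0) * 1"
    using \<open>q (zs ! 0) \<ge> 0\<close> seq_prob_factor by (intro mult_left_mono prod_le_1) auto
  finally show ?thesis using assms by (simp add: hd_conv_nth)
qed

end

lemma seq_prob_eq_0:
  assumes "z \<in> set zs" "q z = 0"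
  shows "seq_prob q zs = 0"
  using assms by (auto simp: seq_prob_def in_set_conv_nth)

section \<open>Distributions favouring a given sequence\<close>

text \<open>Since \<open>x\<close> has mass \<open>1 - e\<close>, conditioning on not drawing
  \<open>x\<close> divides the other values by \<open>e\<close> and leaves the same construction for
  \<open>E - {x}\<close> and \<open>xs\<close>. Shrinking \<open>E\<close> also keeps the listed
  entries out of the final uniform share.\<close>

fun geometric :: "real \<Rightarrow> 'z set \<Rightarrow> 'z list \<Rightarrow> 'z \<Rightarrow> real" where
  "geometric e E [] z = (if z \<in> E then 1 / real (card E) else 0)"
| "geometric e E (x # xs) z = (if z = x then 1 - e else e * geometric e (E - {x}) xs z)"

lemma geometric_outside:
  "set xs \<subseteq> E \<Longrightarrow> z \<notin> E \<Longrightarrow> distinct xs \<Longrightarrow> geometric e E xs z = 0"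
  by (induction xs arbitrary: E) (auto simp: subset_Diff_insert)

lemma geometric_pos:
  "\<lbrakk>finite E; distinct xs; set xs \<subseteq> E; length xs < card E; 0 < e; e < 1; z \<in> E\<rbrakk>
    \<Longrightarrow> 0 < geometric e E xs z"
proof (induction xs arbitrary: E)
  case Nil
  then show ?case by simp
next
  case (Cons x xs)
  show ?case
  proof (cases "z = x")
    case False
    have "0 < geometric e (E - {x}) xs z"
      using Cons.prems False by (intro Cons.IH) auto
    then show ?thesis using Cons.prems False by simp
  qed (use Cons.prems in simp)
qed

text \<open>The strict length bound leaves a nonempty set to carry the uniform share once all
  entries of \<open>xs\<close> are removed.\<close>

lemma sum_geometric:
  "\<lbrakk>finite E; distinct xs; set xs \<subseteq> E; length xs < card E\<rbrakk> \<Longrightarrow> sum (geometric e E xs) E = 1"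
proof (induction xs arbitrary: E)
  case Nil
  then show ?case by auto
next
  case (Cons x xs)
  then have "sum (geometric e (E - {x}) xs) (E - {x}) = 1"
    by (intro Cons.IH) auto
  then show ?case
    using Cons.prems by (simp add: sum.remove[of E x] sum_distrib_left[symmetric])
qed

text \<open>The rest of the sequence must avoid \<open>x\<close>, the only point where the rescaled
  function may differ from the recursive call.\<close>

lemma seq_prob_geometric_Cons:
  assumes "e \<noteq> 0" "x \<notin> set zs"
  shows "seq_prob (geometric e E (x # xs)) (x # zs)
    = (1 - e) * seq_prob (geometric e (E - {x}) xs) zs"
  using assms by (subst seq_prob_Cons) (auto intro!: seq_prob_cong)

lemma seq_prob_geometric_prefix:
  "\<lbrakk>e \<noteq> 0; distinct xs; prefix zs xs\<rbrakk> \<Longrightarrow> seq_prob (geometric e E xs) zs = (1 - e) ^ length zs"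
proof (induction xs arbitrary: E zs)
  case (Cons x xs)
  show ?case
  proof (cases zs)
    case Nil
    then show ?thesis by simp
  next
    case (Cons z zs')
    with Cons.prems have "z = x" "prefix zs' xs" "x \<notin> set zs'"
      by (auto dest: set_mono_prefix)
    then show ?thesis
      using Cons Cons.prems Cons.IH by (simp add: seq_prob_geometric_Cons del: geometric.simps)
  qed
qed simp

text \<open>Common initial entries contribute factors \<open>1 - e\<close>, at most 1. At the first
  disagreement the draw is either from a uniform distribution on at least two points or has mass at
  most \<open>e\<close>.\<close>

lemma seq_prob_geometric_not_prefix:
  "\<lbrakk>finite E; distinct xs; set xs \<subseteq> E; length xs < card E; 0 < e; e \<le> 1/2;
    distinct zs; set zs \<subseteq> E; length zs < card E; \<not> prefix zs xs\<rbrakk>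
    \<Longrightarrow> seq_prob (geometric e E xs) zs \<le> 1/2"
proof (induction xs arbitrary: E zs)
  case Nil
  have "seq_prob (geometric e E []) zs \<le> geometric e E [] (hd zs)"
    using Nil sum_geometric[of E "[]"] by (intro seq_prob_le_hd[of E]) auto
  \<comment> \<open>Not being a prefix, \<open>zs\<close> is nonempty, so
    \<open>length zs < card E\<close> gives \<open>E\<close> at least two elements.\<close>
  also have "\<dots> \<le> 1/2"
    using Nil by (cases zs) (auto simp: field_simps)
  finally show ?case .
next
  case (Cons x xs)
  then obtain z zs' where zs: "zs = z # zs'"
    by (cases zs) auto
  show ?case
  proof (cases "z = x")
    case True
    have "seq_prob (geometric e (E - {x}) xs) zs' \<le> 1/2"
      using Cons.prems zs True by (intro Cons.IH) auto
    then have "(1 - e) * seq_prob (geometric e (E - {x}) xs) zs' \<le> (1 - e) * (1/2)"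
      using Cons.prems by (intro mult_left_mono) auto
    also have "\<dots> \<le> 1/2"
      using Cons.prems by simp
    finally show ?thesis
      using Cons.prems zs True by (simp add: seq_prob_geometric_Cons del: geometric.simps)
  next
    case False
    let ?g = "geometric e (E - {x}) xs"
    have pos: "0 < geometric e E (x # xs) y" if "y \<in> E" for y
      using Cons.prems that by (intro geometric_pos) auto
    \<comment> \<open>All examples other than \<open>x\<close> together have mass \<open>e\<close>,
      which bounds the mass of \<open>z\<close>.\<close>
    have "?g z \<le> sum ?g (E - {x})"
      using Cons.prems zs False
      by (intro member_le_sum less_imp_le[OF geometric_pos]) auto
    also have "\<dots> = 1"
      using Cons.prems by (intro sum_geometric) auto
    finally have "e * ?g z \<le> e"
      using Cons.prems by (intro mult_left_le) auto
    also have "e \<le> 1/2"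
      by fact
    finally have "geometric e E (x # xs) (hd zs) \<le> 1/2"
      using False zs by simp
    moreover have "seq_prob (geometric e E (x # xs)) zs \<le> geometric e E (x # xs) (hd zs)"
      using Cons.prems zs pos
      by (intro seq_prob_le_hd[of E] sum_geometric) (auto simp del: geometric.simps intro: less_imp_le)
    ultimately show ?thesis by (rule order.trans[rotated])
  qed
qed

section \<open>Teachers are saturating matchings\<close>

lemma unique_maximizer_iff:
  fixes f :: "'c \<Rightarrow> real"
  assumes "c\<^sub>0 \<in> C"
  shows "{c\<in>C. \<forall>c'\<in>C. f c' \<le> f c} = {c\<^sub>0} \<longleftrightarrow> (\<forall>c\<in>C. c \<noteq> c\<^sub>0 \<longrightarrow> f c < f c\<^sub>0)"
proof
  assume *: "{c\<in>C. \<forall>c'\<in>C. f c' \<le> f c} = {c\<^sub>0}"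
  show "\<forall>c\<in>C. c \<noteq> c\<^sub>0 \<longrightarrow> f c < f c\<^sub>0"
  proof (intro ballI impI)
    fix c assume c: "c \<in> C" "c \<noteq> c\<^sub>0"
    have max: "\<forall>c'\<in>C. f c' \<le> f c\<^sub>0" using * by blast
    obtain c' where "c' \<in> C" "f c < f c'" using * c by force
    with max show "f c < f c\<^sub>0" by force
  qed
next
  assume "\<forall>c\<in>C. c \<noteq> c\<^sub>0 \<longrightarrow> f c < f c\<^sub>0"
  with assms show "{c\<in>C. \<forall>c'\<in>C. f c' \<le> f c} = {c\<^sub>0}"
    by (force intro: less_imp_le)
qed

lemma teacher_iff:
  "teacher C Z L T \<longleftrightarrow> (\<forall>c\<in>C. T c \<in> seqs Z \<and> length (T c) \<le> N_plus C Z L \<and>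
     (\<forall>c'\<in>C. c' \<noteq> c \<longrightarrow> score L (T c) c' < score L (T c) c))"
  by (simp add: teacher_def unique_maximizer_iff)

text \<open>Two concepts with the same sequence would each have to beat the other strictly.\<close>

lemma teacher_inj_on:
  assumes "teacher C Z L T"
  shows "inj_on T C"
  using assms unfolding teacher_iff inj_on_def by (metis less_asym)

text \<open>An inconsistent entry gives the concept score 0 on its own sequence, which cannot
  strictly exceed the nonnegative score of a second concept.\<close>

lemma teacher_consistent:
  assumes fin: "finite Z" and card: "card C \<ge> 2"
    and L: "map_learner C Z models L" and T: "teacher C Z L T" and c: "c \<in> C"
  shows "seq_models models c (T c)"
proof (rule ccontr)
  have seqs: "distinct (T c)" "set (T c) \<subseteq> Z"
    using T c by (auto simp: teacher_iff seqs_def)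
  assume "\<not> seq_models models c (T c)"
  then obtain z where z: "z \<in> set (T c)" "\<not> models c z"
    by (auto simp: seq_models_def)
  then have "likelihood L c z = 0"
    using L c seqs by (auto simp: map_learner_def)
  with z have zero: "score L (T c) c = 0"
    by (simp add: score_def seq_prob_eq_0)
  have "C \<noteq> {c}" using card by auto
  with c obtain c' where c': "c' \<in> C" "c' \<noteq> c" by auto
  then have "0 \<le> score L (T c) c'"
    using fin L seqs unfolding score_def
    by (intro mult_nonneg_nonneg seq_prob_nonneg[of Z]) (auto simp: map_learner_def less_imp_le)
  then show False
    using T c c' zero by (force simp: teacher_iff)
qed

text \<open>The empty sequence has probability 1 under every concept, so uniform priors produce a
  tie.\<close>

lemma mle_teacher_nonempty:
  assumes card: "card C \<ge> 2"
    and L: "mle_learner C Z models L" and T: "teacher C Z L T" and c: "c \<in> C"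
  shows "T c \<noteq> []"
proof
  assume "T c = []"
  have "C \<noteq> {c}" using card by auto
  with c obtain c' where c': "c' \<in> C" "c' \<noteq> c" by auto
  then have "score L (T c) c' = score L (T c) c"
    using L c \<open>T c = []\<close> by (simp add: score_def mle_learner_def)
  then show False
    using T c c' by (force simp: teacher_iff)
qed

section \<open>Saturating matchings are teachers\<close>

text \<open>Bernoulli's inequality bounds the power below by \<open>1 - k * e\<close>, which is at
  least 3/4.\<close>

lemma one_half_less_power:
  fixes e :: real
  assumes "0 \<le> e" "e < 1" "k < n" "e \<le> 1 / (4 * real n)"
  shows "1/2 < (1 - e) ^ k"
proof -
  have "real k * e \<le> real n * (1 / (4 * real n))"
    using assms by (intro mult_mono) auto
  also have "\<dots> = 1/4"
    using assms by simp
  finally have "1/2 < 1 + real k * (- e)" by simp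
  also have "\<dots> \<le> (1 + - e) ^ k"
    using assms by (intro Bernoulli_inequality) auto
  finally show ?thesis by simp
qed

text \<open>Labelled examples enter only through two properties: every concept has the same number
  \<open>n\<close> of consistent examples, and these examples determine it.\<close>

locale uniform_matching =
  fixes C :: "'c set" and Z :: "'z set" and models :: "'c \<Rightarrow> 'z \<Rightarrow> bool" and n :: nat
    and M :: "'c \<Rightarrow> 'z list"
  assumes finC: "finite C" and C_ne: "C \<noteq> {}" and finZ: "finite Z" and n_pos: "n > 0"
    and card_consistent: "\<And>c. c \<in> C \<Longrightarrow> card {z \<in> Z. models c z} = n"
    and inj_consistent: "inj_on (\<lambda>c. {z \<in> Z. models c z}) C"
    and M_seqs: "\<And>c. c \<in> C \<Longrightarrow> M c \<in> seqs Z"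
    and M_consistent: "\<And>c. c \<in> C \<Longrightarrow> seq_models models c (M c)"
    and M_inj: "inj_on M C"
begin

abbreviation consistent :: "'c \<Rightarrow> 'z set" where
  "consistent c \<equiv> {z \<in> Z. models c z}"

text \<open>Longer sequences get a larger value, and the empty one still a positive value. As
  \<open>length (M c)\<close> is at most \<open>n\<close>, the denominator keeps the value below
  \<open>1 / (4 * n)\<close>, as the Bernoulli estimate demands.\<close>

definition eps :: "'c \<Rightarrow> real" where
  "eps c = real (Suc (length (M c))) / (4 * (real n + 1)\<^sup>2)"

text \<open>Dropping the last entry of a sequence of length \<open>n\<close> leaves an example for the rest of the mass.\<close>

definition lik :: "'c \<Rightarrow> 'z \<Rightarrow> real" where
  "lik c = geometric (eps c) (consistent c) (take (n - 1) (M c))"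

lemma M_set: "c \<in> C \<Longrightarrow> set (M c) \<subseteq> consistent c"
  and M_distinct: "c \<in> C \<Longrightarrow> distinct (M c)"
  using M_seqs M_consistent by (auto simp: seqs_def seq_models_def)

lemma length_M_le: "c \<in> C \<Longrightarrow> length (M c) \<le> n"
  using card_mono[OF _ M_set] finZ M_distinct by (simp add: card_consistent distinct_card)

lemma eps_pos: "0 < eps c"
  by (simp add: eps_def add_nonneg_eq_0_iff)

lemma eps_le:
  assumes "c \<in> C"
  shows "eps c \<le> 1 / (4 * real n)" "eps c \<le> 1/2"
proof -
  have "eps c \<le> (real n + 1) / (4 * (real n + 1)\<^sup>2)"
    unfolding eps_def using length_M_le[OF assms] by (intro divide_right_mono) auto
  also have "\<dots> = 1 / (4 * (real n + 1))"
    by (simp add: power2_eq_square)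
  also have "\<dots> \<le> 1 / (4 * real n)"
    using n_pos by (simp add: field_simps)
  finally show le: "eps c \<le> 1 / (4 * real n)" .
  also have "\<dots> \<le> 1/2"
    using n_pos by (simp add: field_simps)
  finally show "eps c \<le> 1/2" .
qed

lemma eps_mono: "length (M c) < length (M c') \<Longrightarrow> eps c < eps c'"
  unfolding eps_def by (intro divide_strict_right_mono) (auto simp: add_nonneg_eq_0_iff)

lemma take_M:
  assumes "c \<in> C"
  shows "distinct (take (n - 1) (M c))" "set (take (n - 1) (M c)) \<subseteq> consistent c"
    "length (take (n - 1) (M c)) < card (consistent c)"
  using M_set[OF assms] M_distinct[OF assms] n_pos card_consistent[OF assms] by (auto dest!: in_set_takeD)

lemma lik_outside: "c \<in> C \<Longrightarrow> z \<notin> consistent c \<Longrightarrow> lik c z = 0"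
  unfolding lik_def using take_M by (intro geometric_outside) auto

lemma lik_pos: "c \<in> C \<Longrightarrow> z \<in> consistent c \<Longrightarrow> 0 < lik c z"
  unfolding lik_def using take_M finZ eps_pos eps_le(2)[of c] by (intro geometric_pos) auto

lemma lik_nonneg: "c \<in> C \<Longrightarrow> 0 \<le> lik c z"
  by (cases "z \<in> consistent c") (auto simp: lik_outside dest: lik_pos)

lemma sum_lik:
  assumes "c \<in> C"
  shows "sum (lik c) Z = 1"
proof -
  have "sum (lik c) Z = sum (lik c) (consistent c)"
    using finZ assms lik_outside by (intro sum.mono_neutral_right) auto
  also have "\<dots> = 1"
    unfolding lik_def using finZ take_M[OF assms] by (intro sum_geometric) auto
  finally show ?thesis .
qed

lemma seq_prob_lik_pos:
  assumes "c \<in> C"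
  shows "0 < seq_prob (lik c) (M c)"
  using assms finZ sum_lik lik_nonneg M_distinct M_set lik_pos
  by (intro seq_prob_pos[of Z]) blast+

text \<open>A rival contradicting \<open>M c\<close> gives it probability 0. Any other rival gives
  at most 1/2, which the concept itself exceeds, unless \<open>M c\<close> is a prefix of the
  rival's favoured sequence; then the two values of \<open>eps\<close> decide.\<close>

lemma seq_prob_lik_less:
  assumes c: "c \<in> C" "c' \<in> C" "c' \<noteq> c" and ne: "M c \<noteq> []"
  shows "seq_prob (lik c') (M c) < seq_prob (lik c) (M c)"
proof (cases "set (M c) \<subseteq> consistent c'")
  case False
  then obtain z where "z \<in> set (M c)" "z \<notin> consistent c'" by blast
  then have "seq_prob (lik c') (M c) = 0"
    using lik_outside[OF c(2)] by (intro seq_prob_eq_0)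
  then show ?thesis using seq_prob_lik_pos[OF c(1)] by simp
next
  case True
  \<comment> \<open>A sequence of length \<open>n\<close> would exhaust the consistent examples of
    both concepts, which would then coincide.\<close>
  have short: "length (M c) < n"
  proof (rule ccontr)
    assume "\<not> length (M c) < n"
    then have "card (set (M c)) = n"
      using c length_M_le M_distinct by (simp add: distinct_card le_antisym)
    then have "set (M c) = consistent c" "set (M c) = consistent c'"
      using c True M_set finZ card_consistent by (simp_all add: card_subset_eq)
    then show False
      using inj_consistent c by (auto simp: inj_on_def)
  qed
  \<comment> \<open>By \<open>short\<close>, \<open>take (n - 1)\<close> leaves \<open>M c\<close>
    whole, so every draw is a favoured one.\<close>
  then have "seq_prob (lik c) (M c) = (1 - eps c) ^ length (M c)"
    unfolding lik_def using eps_pos[of c] M_distinct[OF c(1)]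
    by (subst seq_prob_geometric_prefix) simp_all
  moreover have "seq_prob (lik c') (M c) < (1 - eps c) ^ length (M c)"
  proof (cases "prefix (M c) (take (n - 1) (M c'))")
    case pre: True
    then have "prefix (M c) (M c')"
      using take_is_prefix prefix_order.trans by blast
    \<comment> \<open>Injectivity makes the prefix proper, so the rival's sequence is longer and its
      \<open>eps\<close> larger.\<close>
    moreover have "M c \<noteq> M c'"
      using M_inj c by (auto simp: inj_on_def)
    ultimately have "eps c < eps c'"
      by (intro eps_mono prefix_length_less) (simp add: strict_prefix_def)
    then have "(1 - eps c') ^ length (M c) < (1 - eps c) ^ length (M c)"
      using eps_le(2)[of c'] c ne by (intro power_strict_mono) auto
    then show ?thesis
      unfolding lik_def using pre take_M(1)[OF c(2)] eps_pos[of c']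
      by (subst seq_prob_geometric_prefix) simp_all
  next
    case False
    then have "seq_prob (lik c') (M c) \<le> 1/2"
      unfolding lik_def
      using True short finZ take_M[OF c(2)] eps_pos[of c'] eps_le(2)[OF c(2)] M_distinct[OF c(1)]
        card_consistent[OF c(2)]
      by (intro seq_prob_geometric_not_prefix) simp_all
    also have "1/2 < (1 - eps c) ^ length (M c)"
      using short eps_le[of c] eps_pos[of c] c by (intro one_half_less_power) auto
    finally show ?thesis .
  qed
  ultimately show ?thesis by simp
qed

lemma map_learner_lik:
  assumes "\<And>c. c \<in> C \<Longrightarrow> p c > 0" "sum p C = 1"
  shows "map_learner C Z models \<lparr>prior = p, likelihood = lik\<rparr>"
  using assms lik_nonneg sum_lik lik_outside by (auto simp: map_learner_def)

text \<open>Each likelihood is positive on exactly the consistent examples. The length bound on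
  teachers thus becomes \<open>length_M_le\<close>.\<close>

lemma N_plus_lik: "N_plus C Z \<lparr>prior = p, likelihood = lik\<rparr> = n"
proof -
  have "{z \<in> Z. lik c z > 0} = consistent c" if "c \<in> C" for c
    using that lik_pos lik_outside by force
  then have "(\<lambda>c. card {z \<in> Z. lik c z > 0}) ` C = {n}"
    using C_ne card_consistent by auto
  then show ?thesis by (simp add: N_plus_def)
qed

lemma teacher_lik:
  assumes "\<And>c c'. \<lbrakk>c \<in> C; c' \<in> C; c' \<noteq> c\<rbrakk>
    \<Longrightarrow> p c' * seq_prob (lik c') (M c) < p c * seq_prob (lik c) (M c)"
  shows "teacher C Z \<lparr>prior = p, likelihood = lik\<rparr> M"
  using assms M_seqs length_M_le by (simp add: teacher_iff N_plus_lik score_def)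

lemma ex_mle_learner:
  assumes "\<And>c. c \<in> C \<Longrightarrow> M c \<noteq> []"
  shows "\<exists>L. mle_learner C Z models L \<and> teacher C Z L M"
proof -
  define p :: "'c \<Rightarrow> real" where "p = (\<lambda>_. 1 / real (card C))"
  have "card C > 0" using finC C_ne by (simp add: card_gt_0_iff)
  then have "mle_learner C Z models \<lparr>prior = p, likelihood = lik\<rparr>"
    unfolding mle_learner_def by (auto intro: map_learner_lik simp: p_def)
  moreover have "teacher C Z \<lparr>prior = p, likelihood = lik\<rparr> M"
    using \<open>card C > 0\<close> assms
    by (intro teacher_lik) (simp add: p_def divide_strict_right_mono seq_prob_lik_less)
  ultimately show ?thesis by blast
qed

text \<open>There are finitely many strict inequalities between likelihoods, so all survive a factor
  \<open>1 + d\<close> on the rival's side for some \<open>d > 0\<close>. That factor is free to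
  raise the prior of a concept matched to the empty sequence.\<close>

lemma ex_map_learner: "\<exists>L. map_learner C Z models L \<and> teacher C Z L M"
proof -
  have "\<forall>\<^sub>F d in at_right 0. c' \<noteq> c \<and> M c \<noteq> [] \<longrightarrow>
      (1 + d) * seq_prob (lik c') (M c) < seq_prob (lik c) (M c)"
    if "c \<in> C" "c' \<in> C" for c c'
  proof (cases "c' \<noteq> c \<and> M c \<noteq> []")
    case True
    have "((\<lambda>d. (1 + d) * seq_prob (lik c') (M c)) \<longlongrightarrow> (1 + 0) * seq_prob (lik c') (M c))
        (at_right 0)"
      by (intro tendsto_intros)
    moreover have "(1 + 0) * seq_prob (lik c') (M c) < seq_prob (lik c) (M c)"
      using seq_prob_lik_less that True by simp
    ultimately have "\<forall>\<^sub>F d in at_right 0.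
        (1 + d) * seq_prob (lik c') (M c) < seq_prob (lik c) (M c)"
      by (rule order_tendstoD(2))
    then show ?thesis by (rule eventually_mono) simp
  qed auto
  then have "\<forall>\<^sub>F d in at_right 0. \<forall>c\<in>C. \<forall>c'\<in>C. c' \<noteq> c \<and> M c \<noteq> [] \<longrightarrow>
      (1 + d) * seq_prob (lik c') (M c) < seq_prob (lik c) (M c)"
    by (intro eventually_ball_finite finC ballI)
  then have "\<forall>\<^sub>F d in at_right 0. d > (0::real) \<and> (\<forall>c\<in>C. \<forall>c'\<in>C. c' \<noteq> c \<and> M c \<noteq> [] \<longrightarrow>
      (1 + d) * seq_prob (lik c') (M c) < seq_prob (lik c) (M c))"
    by (intro eventually_conj eventually_at_right_less)
  then have "\<exists>d. d > (0::real) \<and> (\<forall>c\<in>C. \<forall>c'\<in>C. c' \<noteq> c \<and> M c \<noteq> [] \<longrightarrow>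
      (1 + d) * seq_prob (lik c') (M c) < seq_prob (lik c) (M c))"
    by (rule eventually_happens'[rotated]) simp
  then obtain d :: real where d: "d > 0"
    "\<forall>c\<in>C. \<forall>c'\<in>C. c' \<noteq> c \<and> M c \<noteq> [] \<longrightarrow>
      (1 + d) * seq_prob (lik c') (M c) < seq_prob (lik c) (M c)"
    by (elim exE conjE)
  define w where "w c = (if M c = [] then 1 + d else 1)" for c
  define W where "W = sum w C"
  have "W > 0"
    unfolding W_def using finC C_ne d(1) by (intro sum_pos) (auto simp: w_def)
  define p where "p c = w c / W" for c
  have "sum p C = 1"
    using \<open>W > 0\<close> by (simp add: p_def sum_divide_distrib[symmetric] flip: W_def)
  moreover have "p c > 0" for c
    using \<open>W > 0\<close> d(1) by (simp add: p_def w_def)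
  ultimately have "map_learner C Z models \<lparr>prior = p, likelihood = lik\<rparr>"
    by (intro map_learner_lik)
  moreover have "teacher C Z \<lparr>prior = p, likelihood = lik\<rparr> M"
  proof (rule teacher_lik)
    fix c c' assume c: "c \<in> C" "c' \<in> C" "c' \<noteq> c"
    have "w c' * seq_prob (lik c') (M c) < w c * seq_prob (lik c) (M c)"
    proof (cases "M c = []")
      case True
      \<comment> \<open>Both probabilities are 1 here, so the weights decide; only \<open>c\<close>
        has the raised weight.\<close>
      then have "M c' \<noteq> []"
        using inj_onD[OF M_inj, of c' c] c by auto
      with True d(1) show ?thesis by (simp add: w_def)
    next
      case False
      have "0 \<le> seq_prob (lik c') (M c)"
        using finZ lik_nonneg[OF c(2)] sum_lik[OF c(2)] M_distinct[OF c(1)] M_set[OF c(1)]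
        by (intro seq_prob_nonneg[of Z]) auto
      then have "w c' * seq_prob (lik c') (M c) \<le> (1 + d) * seq_prob (lik c') (M c)"
        using d(1) by (intro mult_right_mono) (auto simp: w_def)
      also have "\<dots> < seq_prob (lik c) (M c)"
        using d(2) c False by simp
      finally show ?thesis
        using False by (simp add: w_def)
    qed
    then show "p c' * seq_prob (lik c') (M c) < p c * seq_prob (lik c) (M c)"
      using \<open>W > 0\<close> by (simp add: p_def divide_strict_right_mono)
  qed
  ultimately show ?thesis by blast
qed

end

section \<open>From maps to the equality of the parameters\<close>

lemma saturating_matching_consistency_graph_iff:
  "saturating_matching (consistency_graph C Z models) M \<longleftrightarrow>
     (\<forall>c\<in>C. M c \<in> seqs Z \<and> seq_models models c (M c)) \<and> inj_on M C"
  by (auto simp: saturating_matching_def consistency_graph_def)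

lemma saturating_matching_remove_right_iff:
  "saturating_matching (remove_right v G) M \<longleftrightarrow>
     saturating_matching G M \<and> (\<forall>c\<in>left G. M c \<noteq> v)"
  by (auto simp: saturating_matching_def remove_right_def)

lemma left_graph [simp]:
  "left (consistency_graph C Z models) = C"
  "left (remove_right v G) = left G"
  by (simp_all add: consistency_graph_def remove_right_def)

text \<open>For a fixed map, a suitable learner exists exactly when the map is a saturating
  matching. Both infima therefore range over the same set of orders.\<close>

lemma TD_eq_SMN:
  assumes "finite Z" "card C \<ge> 2" "n > 0"
    and "\<And>c. c \<in> C \<Longrightarrow> card {z \<in> Z. models c z} = n"
    and "inj_on (\<lambda>c. {z \<in> Z. models c z}) C"
  shows "MAP_TD C Z models = SMN (consistency_graph C Z models)"
    and "MLE_TD C Z models = SMN (remove_right [] (consistency_graph C Z models))"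
proof -
  have C: "finite C" "C \<noteq> {}"
    using assms(2) by (auto intro: card_ge_0_finite)
  have matching: "uniform_matching C Z models n M"
    if "saturating_matching (consistency_graph C Z models) M" for M
    using that assms C by unfold_locales (auto simp: saturating_matching_consistency_graph_iff)
  have teacher: "saturating_matching (consistency_graph C Z models) T"
    if "map_learner C Z models L" "teacher C Z L T" for L T
    unfolding saturating_matching_consistency_graph_iff
    using that teacher_consistent[OF assms(1,2) that] teacher_inj_on[OF that(2)]
    by (simp add: teacher_iff)
  have "(\<exists>L. map_learner C Z models L \<and> teacher C Z L T) \<longleftrightarrow>
      saturating_matching (consistency_graph C Z models) T" for T
    using teacher uniform_matching.ex_map_learner[OF matching] by blast
  then show "MAP_TD C Z models = SMN (consistency_graph C Z models)"
    unfolding MAP_TD_def SMN_def left_graph by (intro arg_cong[of _ _ Inf]) blast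
  have "(\<exists>L. mle_learner C Z models L \<and> teacher C Z L T) \<longleftrightarrow>
      saturating_matching (remove_right [] (consistency_graph C Z models)) T" for T
    unfolding saturating_matching_remove_right_iff left_graph
    using teacher mle_teacher_nonempty[OF assms(2)] uniform_matching.ex_mle_learner[OF matching]
    by (metis mle_learner_def)
  then show "MLE_TD C Z models = SMN (remove_right [] (consistency_graph C Z models))"
    unfolding MLE_TD_def SMN_def left_graph by (intro arg_cong[of _ _ Inf]) blast
qed

text \<open>Each point of \<open>X\<close> has exactly one label consistent with \<open>c\<close>,
  so the number of consistent examples is \<open>card X\<close> for every concept.\<close>

lemma consistent_examples:
  assumes "c \<subseteq> X"
  shows "{z \<in> examples X. label_models c z} = (\<lambda>x. (x, x \<in> c)) ` X"
  by (force simp: examples_def label_models_def)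

theorem theorem5p2:
  fixes X :: "'a set" and C :: "'a set set"
  assumes "finite X" and "X \<noteq> {}" and "C \<subseteq> Pow X" and "card C \<ge> 2"
  shows "MAP_TD C (examples X) label_models
           = SMN (consistency_graph C (examples X) label_models)
       \<and> MLE_TD C (examples X) label_models
           = SMN (remove_right [] (consistency_graph C (examples X) label_models))"
proof -
  have "finite (examples X)" "card X > 0"
    using assms by (auto simp: examples_def card_gt_0_iff)
  moreover have "card {z \<in> examples X. label_models c z} = card X" if "c \<in> C" for c
    using that assms by (subst consistent_examples) (auto intro!: card_image inj_onI)
  moreover have "inj_on (\<lambda>c. {z \<in> examples X. label_models c z}) C"
  proof (rule inj_onI)
    fix c c' assume c: "c \<in> C" "c' \<in> C"
      and eq: "{z \<in> examples X. label_models c z} = {z \<in> examples X. label_models c' z}"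
    \<comment> \<open>The positive examples alone recover a concept contained in
      \<open>X\<close>.\<close>
    have "x \<in> c \<longleftrightarrow> x \<in> c'" if "x \<in> X" for x
      using eq[THEN eqset_imp_iff, of "(x, True)"] that
      by (simp add: examples_def label_models_def)
    with c assms(3) show "c = c'" by blast
  qed
  ultimately show ?thesis
    using assms(4) by (intro conjI TD_eq_SMN)
qed

end
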